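(* Let $n\ge 2$ be an integer, let $\mathcal{A}$ be a unital algebra over a commutative unital ring $\mathcal{R}$ with a nontrivial idempotent $e$, and put $f=1-e$. Suppose that $\mathcal{A}$ is $2$- and $(n-1)$-torsion free, and that for each $x\in\mathcal{A}$: $exe\cdot e\mathcal{A}f=\{0\}=f\mathcal{A}e\cdot exe$ implies $exe=0$, and $e\mathcal{A}f\cdot fxf=\{0\}=fxf\cdot f\mathcal{A}e$ implies $fxf=0$. Let $\varphi$ be a Lie $n$-derivation on $\mathcal{A}$. Then $\varphi$ is of the form $\varphi=d+\delta+\gamma$, where $d$ is a derivation on $\mathcal{A}$, $\delta$ is a singular Jordan derivation on $\mathcal{A}$ and $\gamma$ is a linear mapping from $\mathcal{A}$ into the centre $\mathcal{Z}(\mathcal{A})$ vanishing on all $(n-1)$-th commutators of $\mathcal{A}$, if and only if both of the following hold: (i) $f\varphi(e\mathcal{A}e)f\subseteq f\mathcal{Z}(\mathcal{A})f$ and $e\varphi(f\mathcal{A}f)e\subseteq e\mathcal{Z}(\mathcal{A})e$; (ii) $e\varphi(tm)e+f\varphi(mt)f\in\mathcal{Z}(\mathcal{A})$ for each $m\in e\mathcal{A}f$ and $t\in f\mathcal{A}e$.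
   Context: Linear means $\mathcal{R}$-linear. Nontrivial idempotent: $e^2=e$, $e\ne 0,1$. For a positive integer $k$, $\mathcal{A}$ is $k$-torsion free if $kx=0$ implies $x=0$ for each $x\in\mathcal{A}$. $[x,y]=xy-yx$, $x\circ y=xy+yx$. Define $p_1(x_1)=x_1$ and $p_n(x_1,\dots,x_n)=[p_{n-1}(x_1,\dots,x_{n-1}),x_n]$ for $n\ge2$; for $n\ge 2$, $p_n(x_1,\dots,x_n)$ is called an $(n-1)$-th commutator. A linear map $\varphi:\mathcal{A}\to\mathcal{A}$ is a Lie $n$-derivation if $\varphi(p_n(x_1,\dots,x_n))=\sum_{i=1}^n p_n(x_1,\dots,x_{i-1},\varphi(x_i),x_{i+1},\dots,x_n)$ for all $x_1,\dots,x_n\in\mathcal{A}$. A linear map $\delta:\mathcal{A}\to\mathcal{A}$ is a derivation if $\delta(xy)=\delta(x)y+x\delta(y)$, and a Jordan derivation if $\delta(x\circ y)=\delta(x)\circ y+x\circ\delta(y)$, for all $x,y$. A Jordan derivation $\delta$ is singular (with respect to $e$) if $\delta(e\mathcal{A}e)=\{0\}$, $\delta(f\mathcal{A}f)=\{0\}$, $\delta(e\mathcal{A}f)\subseteq f\mathcal{A}e$ and $\delta(f\mathcal{A}e)\subseteq e\mathcal{A}f$. *)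

theory Defs
  imports Complex_Main
begin

locale unital_algebra = module scale
  for scale :: "'r::comm_ring_1 \<Rightarrow> 'a::ring_1 \<Rightarrow> 'a" +
  assumes scale_mult_left: "scale r x * y = scale r (x * y)"
    and scale_mult_right: "x * scale r y = scale r (x * y)"

definition nontrivial_idempotent :: "'a::ring_1 \<Rightarrow> bool" where
  "nontrivial_idempotent e \<longleftrightarrow> e * e = e \<and> e \<noteq> 0 \<and> e \<noteq> 1"

definition torsion_free :: "nat \<Rightarrow> 'a::ring_1 itself \<Rightarrow> bool" where
  "torsion_free k _ \<longleftrightarrow> (\<forall>x::'a. of_nat k * x = 0 \<longrightarrow> x = 0)"

definition centre :: "'a::ring_1 set" where
  "centre = {z. \<forall>x. z * x = x * z}"

definition sandwich :: "'a::ring_1 \<Rightarrow> 'a set \<Rightarrow> 'a \<Rightarrow> 'a set" where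
  "sandwich a S b = (\<lambda>s. a * s * b) ` S"

abbreviation peirce :: "'a::ring_1 \<Rightarrow> 'a \<Rightarrow> 'a set" where
  "peirce a b \<equiv> sandwich a UNIV b"

definition commutator :: "'a::ring_1 \<Rightarrow> 'a \<Rightarrow> 'a" where
  "commutator x y = x * y - y * x"

definition jordan_product :: "'a::ring_1 \<Rightarrow> 'a \<Rightarrow> 'a" where
  "jordan_product x y = x * y + y * x"

text \<open>The arguments of \<open>p\<^sub>n\<close> are the values \<open>x 1, \<dots>, x n\<close>; other values of \<open>x\<close> are
  irrelevant. The equation for \<open>n = 0\<close> is a dummy value.\<close>

fun lie_poly :: "nat \<Rightarrow> (nat \<Rightarrow> 'a::ring_1) \<Rightarrow> 'a" where
  "lie_poly 0 x = 0"
| "lie_poly (Suc 0) x = x 1"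
| "lie_poly (Suc (Suc n)) x = commutator (lie_poly (Suc n) x) (x (Suc (Suc n)))"

definition lie_n_derivation ::
    "('r::comm_ring_1 \<Rightarrow> 'a::ring_1 \<Rightarrow> 'a) \<Rightarrow> nat \<Rightarrow> ('a \<Rightarrow> 'a) \<Rightarrow> bool" where
  "lie_n_derivation scale n \<phi> \<longleftrightarrow> module_hom scale scale \<phi> \<and>
    (\<forall>x. \<phi> (lie_poly n x) = (\<Sum>i = 1..n. lie_poly n (x(i := \<phi> (x i)))))"

definition derivation :: "('r::comm_ring_1 \<Rightarrow> 'a::ring_1 \<Rightarrow> 'a) \<Rightarrow> ('a \<Rightarrow> 'a) \<Rightarrow> bool" where
  "derivation scale \<delta> \<longleftrightarrow> module_hom scale scale \<delta> \<and>
    (\<forall>x y. \<delta> (x * y) = \<delta> x * y + x * \<delta> y)"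

definition jordan_derivation ::
    "('r::comm_ring_1 \<Rightarrow> 'a::ring_1 \<Rightarrow> 'a) \<Rightarrow> ('a \<Rightarrow> 'a) \<Rightarrow> bool" where
  "jordan_derivation scale \<delta> \<longleftrightarrow> module_hom scale scale \<delta> \<and>
    (\<forall>x y. \<delta> (jordan_product x y) = jordan_product (\<delta> x) y + jordan_product x (\<delta> y))"

definition singular_jordan_derivation ::
    "('r::comm_ring_1 \<Rightarrow> 'a::ring_1 \<Rightarrow> 'a) \<Rightarrow> 'a \<Rightarrow> ('a \<Rightarrow> 'a) \<Rightarrow> bool" where
  "singular_jordan_derivation scale e \<delta> \<longleftrightarrow> jordan_derivation scale \<delta> \<and>
    (let f = 1 - e in
      \<delta> ` peirce e e = {0} \<and> \<delta> ` peirce f f = {0} \<and>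
      \<delta> ` peirce e f \<subseteq> peirce f e \<and> \<delta> ` peirce f e \<subseteq> peirce e f)"

end

theory Submission
  imports Defs
begin

text \<open>Write \<open>m\<close> and \<open>t\<close> for elements of the off-diagonal Peirce components \<open>e A f\<close> and \<open>f A e\<close>, and
  \<open>a\<close>, \<open>b\<close> for elements of the corners \<open>e A e\<close> and \<open>f A f\<close>.

  Necessity of the conditions is short. A derivation maps \<open>a\<close> to an element with vanishing
  \<open>f\<close>-corner, and a singular Jordan derivation kills \<open>a\<close>, so that \<open>f \<phi>(a) f = f \<gamma>(a) f\<close>; likewise
  with \<open>e\<close> and \<open>f\<close> exchanged. As \<open>[m, t] = p\<^sub>n(m, f, \<dots>, f, t)\<close>, the map \<open>\<gamma>\<close> agrees on \<open>m t\<close> and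
  \<open>t m\<close>, and the element in the second condition is \<open>\<gamma>(m t)\<close>.

  For sufficiency, subtracting an inner derivation makes \<open>\<phi>(f)\<close> commute with \<open>f\<close>. The
  Lie \<open>n\<close>-derivation identity at \<open>(x, f, \<dots>, f, y)\<close> (\<open>lie_n_derivation_ad_iter\<close>), used for
  \<open>y = f\<close>, then does almost everything. On an off-diagonal \<open>x\<close> it gives \<open>(n - 1) [x, \<phi>(f)] = 0\<close>,
  so \<open>\<phi>(f)\<close> is central (\<open>phi_f_central\<close>); after that it says that \<open>\<phi>\<close> commutes with the iterated
  bracket \<open>x \<mapsto> [\<dots>[x, f], \<dots>, f]\<close> with \<open>n - 1\<close> factors \<open>f\<close>, which is \<open>1\<close> on \<open>e A f\<close>,
  \<open>(-1)\<^sup>n\<^sup>-\<^sup>1\<close> on \<open>f A e\<close> and \<open>0\<close> on both corners. Hence \<open>\<phi>\<close> preserves the sum of the corners and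
  the sum of the off-diagonal components; it may exchange \<open>e A f\<close> and \<open>f A e\<close>, but only when
  \<open>n\<close> is odd, since otherwise the exchanging part equals its own negative.

  Let \<open>\<delta>\<close> be that exchanging part. The first condition says that on a corner \<open>\<phi>\<close> maps back into
  the corner up to a central element, which is unique by faithfulness; let \<open>\<gamma>\<close> collect these
  central elements and put \<open>d = \<phi> - \<delta> - \<gamma>\<close>. The identity at general \<open>y\<close> becomes
  \<open>\<phi>[w, y] = [d w - \<delta> w, y] + [w, \<phi> y]\<close> for off-diagonal \<open>w\<close>, whatever \<open>n\<close> is. Comparing Peirce
  components for \<open>y\<close> in each component yields the product rules with an off-diagonal factor that are
  required of a derivation \<open>d\<close> and of a Jordan derivation \<open>\<delta>\<close>, and faithfulness transfers the
  rule for \<open>d\<close> to products inside a corner. The one place where this does not suffice is \<open>d(m t)\<close>, where a central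
  ambiguity \<open>\<gamma>(t m) - \<gamma>(m t)\<close> remains, and the second condition removes exactly it
  (\<open>derivation_off_off\<close>).

  Finally \<open>\<gamma> = \<phi> - d - \<delta>\<close> is again a Lie \<open>n\<close>-derivation: for odd \<open>n\<close> a Jordan derivation is one,
  and for even \<open>n\<close> the map \<open>\<delta>\<close> is zero. A Lie \<open>n\<close>-derivation with central values kills every value
  of \<open>p\<^sub>n\<close>, because every bracket with a central entry is zero.\<close>

section \<open>Lie polynomials and Lie n-derivations\<close>

lemma lie_poly_Suc:
  "n \<ge> 1 \<Longrightarrow> lie_poly (Suc n) x = commutator (lie_poly n x) (x (Suc n))"
  by (cases n) auto

lemma lie_poly_cong:
  "(\<And>i. 1 \<le> i \<Longrightarrow> i \<le> n \<Longrightarrow> x i = y i) \<Longrightarrow> lie_poly n x = lie_poly n y"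
proof (induction n)
  case (Suc n)
  then show ?case by (cases n) auto
qed simp

lemma lie_poly_update_beyond:
  "n < i \<Longrightarrow> lie_poly n (x(i := u)) = lie_poly n x"
  by (rule lie_poly_cong) auto

lemma commutator_diff_left: "commutator (u - v) y = commutator u y - commutator v y"
  and commutator_diff_right: "commutator y (u - v) = commutator y u - commutator y v"
  and commutator_add_left: "commutator (u + v) y = commutator u y + commutator v y"
  by (simp_all add: commutator_def algebra_simps)

lemma commutator_of_nat_left: "commutator (of_nat k * x) y = of_nat k * commutator x y"
proof -
  have "y * (of_nat k * x) = of_nat k * (y * x)"
    by (metis mult.assoc mult_of_nat_commute)
  then show ?thesis by (simp add: commutator_def right_diff_distrib mult.assoc)
qed

lemma commutator_sum_left: "commutator (\<Sum>i\<in>I. g i) y = (\<Sum>i\<in>I. commutator (g i) y)"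
  by (simp add: commutator_def sum_distrib_left sum_distrib_right sum_subtractf)

lemma lie_poly_update_diff:
  "1 \<le> i \<Longrightarrow> i \<le> n \<Longrightarrow>
    lie_poly n (x(i := u - v)) = lie_poly n (x(i := u)) - lie_poly n (x(i := v))"
proof (induction n)
  case (Suc n)
  show ?case
  proof (cases "n = 0")
    case True
    then show ?thesis using Suc.prems by (simp add: le_Suc_eq)
  next
    case False
    then show ?thesis using Suc
      by (cases "i = Suc n")
        (simp_all add: lie_poly_Suc lie_poly_update_beyond commutator_diff_left commutator_diff_right
          fun_upd_same
          fun_upd_other del: fun_upd_apply)
  qed
qed simp

lemma lie_poly_update_central:
  "z \<in> centre \<Longrightarrow> 1 \<le> i \<Longrightarrow> i \<le> n \<Longrightarrow> 2 \<le> n \<Longrightarrow> lie_poly n (x(i := z)) = 0"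
proof (induction n)
  case (Suc n)
  show ?case
  proof (cases "n = 1")
    case True
    then show ?thesis using Suc.prems
      by (cases "i = 1") (auto simp: commutator_def centre_def numeral_2_eq_2 le_Suc_eq)
  next
    case False
    then show ?thesis using Suc
      by (cases "i = Suc n")
        (simp_all add: lie_poly_Suc lie_poly_update_beyond commutator_def centre_def
          fun_upd_same
          fun_upd_other del: fun_upd_apply)
  qed
qed simp

text \<open>The inductive step behind every product rule for Lie polynomials: the last argument of
  \<open>p\<^sub>n\<^sub>+\<^sub>1\<close> contributes the last summand, the others come from \<open>p\<^sub>n\<close>.\<close>

lemma lie_poly_product_step:
  assumes "n \<ge> 1"
  shows "commutator (\<Sum>i = 1..n. lie_poly n (x(i := D (x i)))) (x (Suc n))
      + commutator (lie_poly n x) (D (x (Suc n)))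
    = (\<Sum>i = 1..Suc n. lie_poly (Suc n) (x(i := D (x i))))"
proof -
  have "(\<Sum>i = 1..n. lie_poly (Suc n) (x(i := D (x i))))
      = (\<Sum>i = 1..n. commutator (lie_poly n (x(i := D (x i)))) (x (Suc n)))"
    using assms by (intro sum.cong) (auto simp: lie_poly_Suc fun_upd_same fun_upd_other simp del: fun_upd_apply)
  then show ?thesis
    using assms by (simp add: lie_poly_Suc lie_poly_update_beyond commutator_sum_left fun_upd_same
          fun_upd_other del: fun_upd_apply)
qed

lemma lie_poly_product_rule:
  assumes "\<And>x y. D (commutator x y) = commutator (D x) y + commutator x (D y)" and "n \<ge> 1"
  shows "D (lie_poly n x) = (\<Sum>i = 1..n. lie_poly n (x(i := D (x i))))"
  using \<open>n \<ge> 1\<close>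
proof (induction n rule: dec_induct)
  case (step n)
  then show ?case
    by (simp only: lie_poly_product_step[symmetric] lie_poly_Suc[OF step(1), of x] assms(1))
qed simp

text \<open>A product rule for double commutators only propagates in steps of two, so it reaches the
  Lie polynomials with an odd number of arguments.\<close>

lemma lie_poly_triple_product_rule:
  assumes "\<And>x y z. D (commutator (commutator x y) z) = commutator (commutator (D x) y) z
      + commutator (commutator x (D y)) z + commutator (commutator x y) (D z)"
  shows "D (lie_poly (2 * k + 1) x) = (\<Sum>i = 1..2 * k + 1. lie_poly (2 * k + 1) (x(i := D (x i))))"
proof (induction k)
  case (Suc k)
  let ?n = "2 * k + 1"
  let ?p = "\<lambda>m. \<Sum>i = 1..m. lie_poly m (x(i := D (x i)))"
  have ge1: "1 \<le> ?n" "1 \<le> Suc ?n" and next_odd: "2 * Suc k + 1 = Suc (Suc ?n)" by simp_all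
  have "D (lie_poly (Suc (Suc ?n)) x)
      = D (commutator (commutator (lie_poly ?n x) (x (Suc ?n))) (x (Suc (Suc ?n))))"
    by (simp add: lie_poly_Suc)
  also have "\<dots> = commutator (commutator (?p ?n) (x (Suc ?n))
      + commutator (lie_poly ?n x) (D (x (Suc ?n)))) (x (Suc (Suc ?n)))
      + commutator (lie_poly (Suc ?n) x) (D (x (Suc (Suc ?n))))"
    unfolding assms Suc.IH by (simp add: commutator_add_left lie_poly_Suc)
  also have "\<dots> = ?p (Suc (Suc ?n))"
    by (simp only: lie_poly_product_step[OF ge1(1)] lie_poly_product_step[OF ge1(2)])
  finally show ?case by (simp only: next_odd)
qed simp

lemma lie_n_derivation_diff:
  assumes "lie_n_derivation scale n \<phi>" and "lie_n_derivation scale n \<psi>"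
  shows "lie_n_derivation scale n (\<lambda>x. \<phi> x - \<psi> x)"
proof -
  have "module_hom scale scale (\<lambda>x. \<phi> x - \<psi> x)"
    using assms unfolding lie_n_derivation_def module_hom_iff
    by (auto simp: module.scale_right_diff_distrib)
  then show ?thesis
    using assms unfolding lie_n_derivation_def
    by (simp add: sum_subtractf[symmetric] lie_poly_update_diff)
qed

lemma lie_n_derivation_of_derivation:
  assumes "derivation scale d" and "n \<ge> 1"
  shows "lie_n_derivation scale n d"
proof -
  have hom: "module_hom scale scale d" and mult: "\<And>x y. d (x * y) = d x * y + x * d y"
    using assms(1) by (auto simp: derivation_def)
  have "d (commutator x y) = commutator (d x) y + commutator x (d y)" for x y
    by (simp add: commutator_def module_hom.diff[OF hom] mult algebra_simps)
  then show ?thesis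
    unfolding lie_n_derivation_def using hom lie_poly_product_rule[of d n] assms(2) by blast
qed

text \<open>Since \<open>[[x, y], z] = x \<circ> (y \<circ> z) - y \<circ> (x \<circ> z)\<close>, double commutators are
  expressible through Jordan products, which a single commutator is not; hence the parity condition.\<close>

lemma lie_n_derivation_of_jordan_derivation:
  assumes "jordan_derivation scale \<delta>" and "odd n"
  shows "lie_n_derivation scale n \<delta>"
proof -
  have hom: "module_hom scale scale \<delta>"
    and jordan: "\<And>x y. \<delta> (jordan_product x y) = jordan_product (\<delta> x) y + jordan_product x (\<delta> y)"
    using assms(1) by (auto simp: jordan_derivation_def)
  have double: "commutator (commutator x y) z
      = jordan_product x (jordan_product y z) - jordan_product y (jordan_product x z)" for x y z :: 'b
    by (simp add: commutator_def jordan_product_def algebra_simps)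
  obtain k where n: "n = 2 * k + 1"
    using \<open>odd n\<close> by (rule oddE)
  have "\<delta> (commutator (commutator x y) z) = commutator (commutator (\<delta> x) y) z
      + commutator (commutator x (\<delta> y)) z + commutator (commutator x y) (\<delta> z)" for x y z
    unfolding double module_hom.diff[OF hom] jordan
    by (simp add: jordan_product_def algebra_simps)
  then show ?thesis
    unfolding lie_n_derivation_def n using hom lie_poly_triple_product_rule[of \<delta> k] by blast
qed

lemma lie_n_derivation_central_vanishes:
  assumes "lie_n_derivation scale n \<gamma>" and "range \<gamma> \<subseteq> centre" and "n \<ge> 2"
  shows "\<gamma> (lie_poly n x) = 0"
proof -
  have "\<gamma> (lie_poly n x) = (\<Sum>i = 1..n. lie_poly n (x(i := \<gamma> (x i))))"
    using assms(1) by (simp add: lie_n_derivation_def)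
  also have "\<dots> = 0"
    using assms(2,3) by (intro sum.neutral ballI lie_poly_update_central) auto
  finally show ?thesis .
qed

definition ad_iter :: "'a::ring_1 \<Rightarrow> nat \<Rightarrow> 'a \<Rightarrow> 'a" where
  "ad_iter c k x = ((\<lambda>y. commutator y c) ^^ k) x"

lemma ad_iter_0 [simp]: "ad_iter c 0 x = x"
  and ad_iter_Suc [simp]: "ad_iter c (Suc k) x = commutator (ad_iter c k x) c"
  by (simp_all add: ad_iter_def)

lemma lie_poly_ad_iter:
  "lie_poly (Suc k) (\<lambda>i. if i = 1 then x else c) = ad_iter c k x"
  by (induction k) (simp_all add: lie_poly_Suc)

lemma commutator_right_swap:
  assumes "c * c' = c' * c"
  shows "commutator (commutator x c) c' = commutator (commutator x c') c"
proof -
  have "x * c * c' = x * c' * c" and "c' * (c * x) = c * (c' * x)"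
    using assms by (metis mult.assoc)+
  then show ?thesis by (simp add: commutator_def algebra_simps)
qed

text \<open>The position of \<open>c'\<close> does not matter because the brackets with \<open>c\<close> and with
  \<open>c'\<close> commute.\<close>

lemma lie_poly_ad_iter_update:
  assumes "c * c' = c' * c"
  shows "2 \<le> i \<Longrightarrow> i \<le> Suc k \<Longrightarrow>
    lie_poly (Suc k) ((\<lambda>i. if i = 1 then x else c)(i := c')) = commutator (ad_iter c (k - 1) x) c'"
proof (induction k)
  case (Suc k)
  let ?X = "\<lambda>i::nat. if i = 1 then x else c"
  show ?case
  proof (cases "i = Suc (Suc k)")
    case True
    then show ?thesis
      by (simp add: lie_poly_Suc lie_poly_update_beyond lie_poly_ad_iter[unfolded One_nat_def]
        fun_upd_same fun_upd_other del: fun_upd_apply)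
  next
    case False
    then have "i \<le> Suc k" and "k \<noteq> 0" using Suc.prems by auto
    then obtain j where k: "k = Suc j" by (cases k) auto
    show ?thesis
      using Suc.IH[OF \<open>2 \<le> i\<close> \<open>i \<le> Suc k\<close>] False Suc.prems(1)
      by (simp add: lie_poly_Suc k commutator_right_swap[OF assms] fun_upd_same
          fun_upd_other del: fun_upd_apply)
  qed
qed simp

lemma lie_poly_ad_iter_last:
  "lie_poly (k + 2) ((\<lambda>i. if i = 1 then x else c)(Suc (Suc k) := y)) = commutator (ad_iter c k x) y"
  by (simp add: lie_poly_Suc lie_poly_update_beyond lie_poly_ad_iter[unfolded One_nat_def]
      fun_upd_same fun_upd_other del: fun_upd_apply)

text \<open>The Lie \<open>n\<close>-derivation identity at \<open>(x, f, \<dots>, f, y)\<close>. Since \<open>\<phi> f\<close> commutes with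
  \<open>f\<close>, the \<open>k = n - 2\<close> summands in which \<open>\<phi>\<close> hits a copy of \<open>f\<close> all coincide. For \<open>k = 0\<close> the
  truncated difference \<open>k - 1\<close> is harmless, as the factor \<open>k\<close> vanishes.\<close>

lemma lie_n_derivation_ad_iter:
  assumes "lie_n_derivation scale (k + 2) \<phi>" and comm: "f * \<phi> f = \<phi> f * f"
  shows "\<phi> (commutator (ad_iter f k x) y) = commutator (ad_iter f k (\<phi> x)) y
    + commutator (ad_iter f k x) (\<phi> y)
    + of_nat k * commutator (commutator (ad_iter f (k - 1) x) (\<phi> f)) y"
proof -
  let ?X = "\<lambda>i::nat. if i = 1 then x else f"
  let ?Y = "?X(Suc (Suc k) := y)"
  have "\<phi> (commutator (ad_iter f k x) y) = \<phi> (lie_poly (k + 2) ?Y)"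
    by (simp only: lie_poly_ad_iter_last)
  also have "\<dots> = (\<Sum>i = 1..Suc (Suc k). lie_poly (Suc (Suc k)) (?Y(i := \<phi> (?Y i))))"
    using assms(1) unfolding lie_n_derivation_def add_2_eq_Suc' by blast
  also have "\<dots> = commutator (\<Sum>i = 1..Suc k. lie_poly (Suc k) (?Y(i := \<phi> (?Y i)))) y
      + commutator (ad_iter f k x) (\<phi> y)"
    by (subst lie_poly_product_step[symmetric])
      (simp_all add: lie_poly_update_beyond lie_poly_ad_iter[unfolded One_nat_def])
  also have "(\<Sum>i = 1..Suc k. lie_poly (Suc k) (?Y(i := \<phi> (?Y i))))
      = (\<Sum>i = 1..Suc k. lie_poly (Suc k) (?X(i := \<phi> (?X i))))"
    by (intro sum.cong lie_poly_cong) auto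
  also have "\<dots> = lie_poly (Suc k) (?X(1 := \<phi> x))
      + (\<Sum>i = 2..Suc k. lie_poly (Suc k) (?X(i := \<phi> f)))"
    by (subst sum.atLeast_Suc_atMost) (auto simp: numeral_2_eq_2 intro!: sum.cong)
  also have "lie_poly (Suc k) (?X(1 := \<phi> x)) = ad_iter f k (\<phi> x)"
    by (subst lie_poly_ad_iter[symmetric]) (auto intro: lie_poly_cong)
  also have "(\<Sum>i = 2..Suc k. lie_poly (Suc k) (?X(i := \<phi> f)))
      = of_nat k * commutator (ad_iter f (k - 1) x) (\<phi> f)"
    using lie_poly_ad_iter_update[OF comm] by simp
  finally show ?thesis
    by (simp add: commutator_add_left commutator_of_nat_left)
qed

section \<open>Peirce decomposition\<close>

lemma peirceI: "i * x = x \<Longrightarrow> x * j = x \<Longrightarrow> x \<in> peirce i j"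
  unfolding sandwich_def by (metis rangeI)

lemma peirce_sandwich [simp]: "i * x * j \<in> peirce i j"
  unfolding sandwich_def by blast

lemma peirce_zero [simp]: "0 \<in> peirce i j"
  using peirce_sandwich[of i 0 j] by simp

lemma peirce_add: "x \<in> peirce i j \<Longrightarrow> y \<in> peirce i j \<Longrightarrow> x + y \<in> peirce i j"
proof -
  assume "x \<in> peirce i j" "y \<in> peirce i j"
  then obtain u v where "x = i * u * j" "y = i * v * j" by (auto simp: sandwich_def)
  then have "x + y = i * (u + v) * j" by (simp add: algebra_simps)
  then show ?thesis by simp
qed

lemma peirce_diff: "x \<in> peirce i j \<Longrightarrow> y \<in> peirce i j \<Longrightarrow> x - y \<in> peirce i j"
proof -
  assume "x \<in> peirce i j" "y \<in> peirce i j"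
  then obtain u v where "x = i * u * j" "y = i * v * j" by (auto simp: sandwich_def)
  then have "x - y = i * (u - v) * j" by (simp add: algebra_simps)
  then show ?thesis by simp
qed

lemma peirce_mult: "x \<in> peirce i j \<Longrightarrow> y \<in> peirce k l \<Longrightarrow> x * y \<in> peirce i l"
proof -
  assume "x \<in> peirce i j" "y \<in> peirce k l"
  then obtain u v where "x = i * u * j" "y = k * v * l" by (auto simp: sandwich_def)
  then have "x * y = i * (u * j * k * v) * l" by (simp add: mult.assoc)
  then show ?thesis by simp
qed

lemma peirce_mult_zero: "j * k = 0 \<Longrightarrow> x \<in> peirce i j \<Longrightarrow> y \<in> peirce k l \<Longrightarrow> x * y = 0"
proof -
  assume "j * k = 0" "x \<in> peirce i j" "y \<in> peirce k l"
  then obtain u v where "x = i * u * j" "y = k * v * l" by (auto simp: sandwich_def)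
  then have "x * y = i * u * (j * k) * v * l" by (simp add: mult.assoc)
  then show ?thesis using \<open>j * k = 0\<close> by simp
qed

lemma peirce_commutator:
  assumes "x \<in> peirce i j" and "c * i = i * c" and "j * c = c * j"
  shows "commutator x c \<in> peirce i j"
proof -
  obtain u where x: "x = i * u * j" using assms(1) by (auto simp: sandwich_def)
  have "x * c = i * (u * c) * j"
    unfolding x by (simp only: mult.assoc assms(3))
  moreover have "c * x = i * (c * u) * j"
    unfolding x by (simp only: assms(2) flip: mult.assoc)
  ultimately have "commutator x c = i * (u * c - c * u) * j"
    by (simp add: commutator_def left_diff_distrib right_diff_distrib)
  then show ?thesis by simp
qed

lemma centreD: "z \<in> centre \<Longrightarrow> z * x = x * z"
  by (simp add: centre_def)

lemma centre_zero [simp]: "0 \<in> centre"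
  by (simp add: centre_def)

lemma centre_add: "z \<in> centre \<Longrightarrow> w \<in> centre \<Longrightarrow> z + w \<in> centre"
  and centre_diff: "z \<in> centre \<Longrightarrow> w \<in> centre \<Longrightarrow> z - w \<in> centre"
  by (auto simp: centre_def algebra_simps)

lemma commutator_centre: "z \<in> centre \<Longrightarrow> commutator x z = 0"
  by (simp add: commutator_def centreD)

text \<open>The axioms are symmetric in \<open>e\<close> and \<open>f\<close>, so that each lemma about one Peirce component
  yields its mirror image by exchanging the two idempotents (\<open>swap\<close>).\<close>

locale peirce_decomposition =
  fixes e f :: "'a::ring_1"
  assumes e_idem: "e * e = e" and f_idem: "f * f = f"
    and e_f: "e * f = 0" and f_e: "f * e = 0" and e_plus_f: "e + f = 1"
begin

lemma swap: "peirce_decomposition f e"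
  using e_idem f_idem e_f f_e e_plus_f by unfold_locales (simp_all add: add.commute)

lemma e_idem': "e * (e * x) = e * x" and f_idem': "f * (f * x) = f * x"
  and e_f': "e * (f * x) = 0" and f_e': "f * (e * x) = 0"
  by (simp_all add: e_idem f_idem e_f f_e flip: mult.assoc)

lemmas idem_simps = e_idem f_idem e_f f_e e_idem' f_idem' e_f' f_e' mult.assoc

lemma peirce_left: "x \<in> peirce e j \<Longrightarrow> e * x = x" "x \<in> peirce e j \<Longrightarrow> f * x = 0"
  and peirce_left': "x \<in> peirce f j \<Longrightarrow> f * x = x" "x \<in> peirce f j \<Longrightarrow> e * x = 0"
  and peirce_right: "x \<in> peirce j e \<Longrightarrow> x * e = x" "x \<in> peirce j e \<Longrightarrow> x * f = 0"
  and peirce_right': "x \<in> peirce j f \<Longrightarrow> x * f = x" "x \<in> peirce j f \<Longrightarrow> x * e = 0"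
  by (auto simp: sandwich_def idem_simps)

lemmas peirce_simps = peirce_left peirce_left' peirce_right peirce_right'

lemma peirce_orthogonal:
  "x \<in> peirce i e \<Longrightarrow> y \<in> peirce f l \<Longrightarrow> x * y = 0"
  "x \<in> peirce i f \<Longrightarrow> y \<in> peirce e l \<Longrightarrow> x * y = 0"
  using peirce_mult_zero e_f f_e by blast+

lemma peirce_disjoint: "x \<in> peirce e j \<Longrightarrow> x \<in> peirce f l \<Longrightarrow> x = 0"
  using peirce_left(2) peirce_left'(1) by metis

lemma peirce_sum: "x = e * x * e + e * x * f + f * x * e + f * x * f"
proof -
  have "x = (e + f) * x * (e + f)" by (simp add: e_plus_f)
  then show ?thesis by (simp add: algebra_simps)
qed

lemma commute_f_iff: "x * f = f * x \<longleftrightarrow> e * x * f = 0 \<and> f * x * e = 0"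
proof
  assume comm: "x * f = f * x"
  have "e * x * f = e * (x * f) * f" and "f * x * e = f * (f * x) * e"
    by (simp_all add: idem_simps)
  then have "e * x * f = e * (f * x) * f" and "f * x * e = f * (x * f) * e"
    by (simp_all only: comm)
  then show "e * x * f = 0 \<and> f * x * e = 0"
    by (simp add: idem_simps)
next
  assume off: "e * x * f = 0 \<and> f * x * e = 0"
  have "(e + f) * (x * f) = e * x * f + f * x * f" and "(f * x) * (e + f) = f * x * e + f * x * f"
    by (simp_all only: distrib_left distrib_right mult.assoc)
  then have "x * f = e * x * f + f * x * f" and "f * x = f * x * e + f * x * f"
    by (simp_all only: e_plus_f mult_1_left mult_1_right)
  then show "x * f = f * x" using off by simp
qed

lemma peirce_induct:
  assumes "\<And>x y. P x \<Longrightarrow> P y \<Longrightarrow> P (x + y)"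
    and "\<And>i j x. i \<in> {e, f} \<Longrightarrow> j \<in> {e, f} \<Longrightarrow> x \<in> peirce i j \<Longrightarrow> P x"
  shows "P x"
proof -
  have "P (i * x * j)" if "i \<in> {e, f}" "j \<in> {e, f}" for i j
    using assms(2)[OF that peirce_sandwich] .
  then show ?thesis
    by (subst peirce_sum) (intro assms(1); simp)
qed

lemma biadditive_zero:
  assumes "\<And>x x' y. B (x + x') y = B x y + B x' y"
    and "\<And>x y y'. B x (y + y') = B x y + B x y'"
    and "\<And>i j k l x y. i \<in> {e, f} \<Longrightarrow> j \<in> {e, f} \<Longrightarrow> k \<in> {e, f} \<Longrightarrow> l \<in> {e, f} \<Longrightarrow>
      x \<in> peirce i j \<Longrightarrow> y \<in> peirce k l \<Longrightarrow> B x y = 0"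
  shows "B x y = (0 :: 'b::monoid_add)"
proof (induction x rule: peirce_induct)
  case (2 i j x)
  then show ?case
    by (induction y rule: peirce_induct) (simp_all add: assms(2), blast intro: assms(3))
qed (simp add: assms(1))

end

locale faithful_peirce = peirce_decomposition +
  assumes faithful_e: "a \<in> peirce e e \<Longrightarrow> (\<And>m. m \<in> peirce e f \<Longrightarrow> a * m = 0) \<Longrightarrow>
      (\<And>t. t \<in> peirce f e \<Longrightarrow> t * a = 0) \<Longrightarrow> a = 0"
    and faithful_f: "b \<in> peirce f f \<Longrightarrow> (\<And>t. t \<in> peirce f e \<Longrightarrow> b * t = 0) \<Longrightarrow>
      (\<And>m. m \<in> peirce e f \<Longrightarrow> m * b = 0) \<Longrightarrow> b = 0"
begin

lemma swap_faithful: "faithful_peirce f e"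
  by (intro faithful_peirce.intro swap faithful_peirce_axioms.intro) (fact faithful_f faithful_e)+

text \<open>A central \<open>z\<close> in a corner satisfies \<open>z m = m z = 0\<close>, since \<open>m\<close> ends in the other
  corner. This makes the central correction of a map on a corner unique.\<close>

lemma central_corner_zero:
  assumes "z \<in> centre" and "z \<in> peirce e e"
  shows "z = 0"
  using assms(2)
proof (rule faithful_e)
  fix m assume "m \<in> peirce e f"
  then show "z * m = 0"
    using assms peirce_orthogonal(2) by (metis centreD)
next
  fix t assume "t \<in> peirce f e"
  then show "t * z = 0"
    using assms peirce_orthogonal(1) by (metis centreD)
qed

text \<open>The bracket \<open>[c, a]\<close> lies in the corner and annihilates the off-diagonal
  components, because \<open>c\<close> commutes with \<open>m\<close>, \<open>a m\<close>, \<open>t\<close> and \<open>t a\<close>.\<close>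

lemma commutes_with_corner:
  assumes c: "c * e = e * c"
    and cm: "\<And>m. m \<in> peirce e f \<Longrightarrow> c * m = m * c"
    and ct: "\<And>t. t \<in> peirce f e \<Longrightarrow> c * t = t * c"
    and a: "a \<in> peirce e e"
  shows "c * a = a * c"
proof -
  have ea: "e * a = a" and ae: "a * e = a" using a peirce_simps by blast+
  have "e * (c * a) = c * (e * a)" and "(a * c) * e = (a * e) * c"
    using c by (simp_all only: mult.assoc) (simp_all only: c flip: mult.assoc)
  moreover have "e * (a * c) = (e * a) * c" and "(c * a) * e = c * (a * e)"
    by (simp_all only: mult.assoc)
  ultimately have "e * (c * a - a * c) = c * a - a * c" "(c * a - a * c) * e = c * a - a * c"
    by (simp_all only: ea ae right_diff_distrib left_diff_distrib)
  then have "c * a - a * c \<in> peirce e e" by (rule peirceI)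
  then have "c * a - a * c = 0"
  proof (rule faithful_e)
    fix m assume m: "m \<in> peirce e f"
    have "c * (a * m) = (a * m) * c" and "c * m = m * c"
      using cm m peirce_mult[OF a m] by auto
    then show "(c * a - a * c) * m = 0" by (simp add: left_diff_distrib mult.assoc)
  next
    fix t assume t: "t \<in> peirce f e"
    have "c * (t * a) = (t * a) * c" and "c * t = t * c"
      using ct t peirce_mult[OF t a] by auto
    then show "t * (c * a - a * c) = 0"
      by (simp add: right_diff_distrib) (metis mult.assoc)
  qed
  then show ?thesis by simp
qed

lemma centreI:
  assumes c: "c * f = f * c"
    and cm: "\<And>m. m \<in> peirce e f \<Longrightarrow> c * m = m * c"
    and ct: "\<And>t. t \<in> peirce f e \<Longrightarrow> c * t = t * c"
  shows "c \<in> centre"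
proof -
  have "c * (e + f) = (e + f) * c" by (simp add: e_plus_f)
  then have ce: "c * e = e * c" using c by (simp add: algebra_simps)
  have "c * x = x * c" for x
  proof (induction x rule: peirce_induct)
    case (2 i j x)
    then show ?case
      using cm ct commutes_with_corner[OF ce cm ct]
        faithful_peirce.commutes_with_corner[OF swap_faithful c ct cm] by blast
  qed (simp add: algebra_simps)
  then show ?thesis by (simp add: centre_def)
qed

end

section \<open>Splitting a reduced map\<close>

text \<open>The part of \<open>\<phi>\<close> that exchanges the two off-diagonal Peirce components.\<close>

definition flip_part :: "'a::ring_1 \<Rightarrow> 'a \<Rightarrow> ('a \<Rightarrow> 'a) \<Rightarrow> 'a \<Rightarrow> 'a" where
  "flip_part e f \<phi> x = f * \<phi> (e * x * f) * e + e * \<phi> (f * x * e) * f"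

text \<open>The choice is unique whenever it exists (\<open>central_corner_zero\<close>), which makes it linear in
  \<open>a\<close>.\<close>

definition central_shift :: "'a::ring_1 \<Rightarrow> ('a \<Rightarrow> 'a) \<Rightarrow> 'a \<Rightarrow> 'a" where
  "central_shift e \<phi> a = (SOME z. z \<in> centre \<and> \<phi> a - z \<in> peirce e e)"

definition central_part :: "'a::ring_1 \<Rightarrow> 'a \<Rightarrow> ('a \<Rightarrow> 'a) \<Rightarrow> 'a \<Rightarrow> 'a" where
  "central_part e f \<phi> x = central_shift e \<phi> (e * x * e) + central_shift f \<phi> (f * x * f)"

definition derivation_part :: "'a::ring_1 \<Rightarrow> 'a \<Rightarrow> ('a \<Rightarrow> 'a) \<Rightarrow> 'a \<Rightarrow> 'a" where
  "derivation_part e f \<phi> x = \<phi> x - flip_part e f \<phi> x - central_part e f \<phi> x"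

lemma flip_part_swap: "flip_part f e = flip_part e f"
  and central_part_swap: "central_part f e = central_part e f"
  by (simp_all add: fun_eq_iff flip_part_def central_part_def add.commute)

lemma derivation_part_swap: "derivation_part f e = derivation_part e f"
  by (simp add: fun_eq_iff derivation_part_def flip_part_swap central_part_swap)

text \<open>What remains of a Lie \<open>n\<close>-derivation with block diagonal \<open>\<phi> f\<close> under the two conditions,
  stated without reference to \<open>n\<close> and symmetrically in \<open>e\<close> and \<open>f\<close>. In the bracket rules the
  exchanging part of \<open>\<phi> m\<close> enters with a negative sign: the identity at \<open>(m, f, \<dots>, f, y)\<close>
  brackets it \<open>n - 2\<close> times with \<open>f\<close>, and it is nonzero only for odd \<open>n\<close>.\<close>

locale reduced_map = faithful_peirce e f + unital_algebra scale
  for e f :: "'a::ring_1" and scale :: "'r::comm_ring_1 \<Rightarrow> 'a \<Rightarrow> 'a" +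
  fixes \<phi> :: "'a \<Rightarrow> 'a"
  assumes hom: "module_hom scale scale \<phi>"
    and bracket_ef: "m \<in> peirce e f \<Longrightarrow>
      \<phi> (commutator m y) = commutator (e * \<phi> m * f - f * \<phi> m * e) y + commutator m (\<phi> y)"
    and bracket_fe: "t \<in> peirce f e \<Longrightarrow>
      \<phi> (commutator t y) = commutator (f * \<phi> t * e - e * \<phi> t * f) y + commutator t (\<phi> y)"
    and off_ef: "m \<in> peirce e f \<Longrightarrow> \<phi> m = e * \<phi> m * f + f * \<phi> m * e"
    and off_fe: "t \<in> peirce f e \<Longrightarrow> \<phi> t = f * \<phi> t * e + e * \<phi> t * f"
    and corner_e: "a \<in> peirce e e \<Longrightarrow> \<exists>z \<in> centre. \<phi> a - z \<in> peirce e e"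
    and corner_f: "b \<in> peirce f f \<Longrightarrow> \<exists>z \<in> centre. \<phi> b - z \<in> peirce f f"
    and cross: "m \<in> peirce e f \<Longrightarrow> t \<in> peirce f e \<Longrightarrow>
      e * \<phi> (t * m) * e + f * \<phi> (m * t) * f \<in> centre"
begin

lemma swap_reduced: "reduced_map f e scale \<phi>"
proof (intro reduced_map.intro swap_faithful unital_algebra_axioms reduced_map_axioms.intro hom)
  fix m t assume "m \<in> peirce f e" "t \<in> peirce e f"
  then show "f * \<phi> (t * m) * f + e * \<phi> (m * t) * e \<in> centre"
    using cross by (subst add.commute)
qed (fact bracket_ef bracket_fe off_ef off_fe corner_e corner_f)+

abbreviation "\<delta> \<equiv> flip_part e f \<phi>"
abbreviation "\<gamma> \<equiv> central_part e f \<phi>"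
abbreviation "d \<equiv> derivation_part e f \<phi>"

lemmas phi_simps = module_hom.add[OF hom] module_hom.diff[OF hom] module_hom.neg[OF hom]
  module_hom.zero[OF hom] module_hom.scale[OF hom]

lemma central_shift:
  assumes "a \<in> peirce e e"
  shows "central_shift e \<phi> a \<in> centre" and "\<phi> a - central_shift e \<phi> a \<in> peirce e e"
proof -
  have "\<exists>z. z \<in> centre \<and> \<phi> a - z \<in> peirce e e" using corner_e[OF assms] by blast
  then show "central_shift e \<phi> a \<in> centre" and "\<phi> a - central_shift e \<phi> a \<in> peirce e e"
    unfolding central_shift_def by (metis (mono_tags, lifting) someI_ex)+
qed

lemma central_shift_eqI:
  assumes "z \<in> centre" and "\<phi> a - z \<in> peirce e e"
  shows "central_shift e \<phi> a = z"
proof -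
  have "\<exists>z. z \<in> centre \<and> \<phi> a - z \<in> peirce e e" using assms by blast
  then have *: "central_shift e \<phi> a \<in> centre" "\<phi> a - central_shift e \<phi> a \<in> peirce e e"
    unfolding central_shift_def by (metis (mono_tags, lifting) someI_ex)+
  have "(\<phi> a - z) - (\<phi> a - central_shift e \<phi> a) \<in> peirce e e"
    by (rule peirce_diff[OF assms(2) *(2)])
  then have "central_shift e \<phi> a - z \<in> peirce e e" by simp
  then have "central_shift e \<phi> a - z = 0"
    using central_corner_zero centre_diff[OF *(1) assms(1)] by blast
  then show ?thesis by simp
qed

lemma central_shift_zero: "central_shift e \<phi> 0 = 0"
  by (rule central_shift_eqI) (simp_all add: phi_simps)

lemma central_shift_hom: "module_hom scale scale (\<lambda>x. central_shift e \<phi> (e * x * e))"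
proof -
  let ?c = "\<lambda>x. central_shift e \<phi> (e * x * e)"
  have "?c (x + y) = ?c x + ?c y" for x y
  proof (rule central_shift_eqI)
    have "\<phi> (e * (x + y) * e) - (?c x + ?c y) = (\<phi> (e * x * e) - ?c x) + (\<phi> (e * y * e) - ?c y)"
      by (simp add: phi_simps algebra_simps)
    then show "\<phi> (e * (x + y) * e) - (?c x + ?c y) \<in> peirce e e"
      by (simp only: peirce_add central_shift(2) peirce_sandwich)
  qed (simp add: central_shift centre_add)
  moreover have "?c (scale r x) = scale r (?c x)" for r x
  proof (rule central_shift_eqI)
    show "scale r (?c x) \<in> centre"
      using central_shift(1)[OF peirce_sandwich]
      by (simp add: centre_def scale_mult_left scale_mult_right)
    let ?y = "\<phi> (e * x * e) - ?c x"
    have "e * ?y = ?y" and "?y * e = ?y"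
      using central_shift(2)[OF peirce_sandwich] peirce_left(1) peirce_right(1) by blast+
    then have "scale r ?y \<in> peirce e e"
      by (intro peirceI) (simp_all only: scale_mult_left scale_mult_right)
    then show "\<phi> (e * scale r x * e) - scale r (?c x) \<in> peirce e e"
      by (simp add: scale_mult_left scale_mult_right phi_simps scale_right_diff_distrib)
  qed
  ultimately show ?thesis
    using module_axioms unfolding module_hom_iff by blast
qed

lemma flip_hom: "module_hom scale scale \<delta>"
  unfolding module_hom_iff flip_part_def
  by (simp add: module_axioms phi_simps scale_mult_left scale_mult_right algebra_simps)

lemma central_hom: "module_hom scale scale \<gamma>"
  using central_shift_hom reduced_map.central_shift_hom[OF swap_reduced]
  unfolding module_hom_iff central_part_def by (simp add: algebra_simps)

lemma central_part_centre: "\<gamma> x \<in> centre"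
  unfolding central_part_def
  using central_shift(1) reduced_map.central_shift(1)[OF swap_reduced] by (simp add: centre_add)

lemma derivation_part_hom: "module_hom scale scale d"
  using hom flip_hom central_hom unfolding module_hom_iff derivation_part_def
  by (simp add: algebra_simps)

lemmas swapped_zero = reduced_map.central_shift_zero[OF swap_reduced]

lemma parts_corner:
  assumes "a \<in> peirce e e"
  shows "\<delta> a = 0" and "\<gamma> a = central_shift e \<phi> a" and "\<phi> a = d a + \<gamma> a" and "d a \<in> peirce e e"
proof -
  show *: "\<delta> a = 0" "\<gamma> a = central_shift e \<phi> a"
    using assms by (simp_all add: flip_part_def central_part_def peirce_simps phi_simps swapped_zero)
  show "\<phi> a = d a + \<gamma> a" "d a \<in> peirce e e"
    using assms * central_shift(2) by (simp_all add: derivation_part_def)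
qed

lemma parts_off:
  assumes "m \<in> peirce e f"
  shows "\<delta> m = f * \<phi> m * e" and "\<gamma> m = 0" and "d m = e * \<phi> m * f" and "\<phi> m = d m + \<delta> m"
    and "\<delta> m \<in> peirce f e" and "d m \<in> peirce e f"
proof -
  show *: "\<delta> m = f * \<phi> m * e" "\<gamma> m = 0"
    using assms
    by (simp_all add: flip_part_def central_part_def peirce_simps phi_simps swapped_zero central_shift_zero)
  have "\<phi> m - f * \<phi> m * e = e * \<phi> m * f"
    using off_ef[OF assms] by (metis add_diff_cancel_right')
  with * show **: "d m = e * \<phi> m * f"
    by (simp add: derivation_part_def)
  show "\<phi> m = d m + \<delta> m"
    unfolding * ** by (rule off_ef[OF assms])
  show "\<delta> m \<in> peirce f e" "d m \<in> peirce e f"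
    unfolding * ** by simp_all
qed

lemmas parts_corner_f = reduced_map.parts_corner[OF swap_reduced,
    unfolded flip_part_swap[of f e] central_part_swap[of f e] derivation_part_swap[of f e]]
lemmas parts_off_fe = reduced_map.parts_off[OF swap_reduced,
    unfolded flip_part_swap[of f e] central_part_swap[of f e] derivation_part_swap[of f e]]

lemma bracket:
  assumes "m \<in> peirce e f"
  shows "\<phi> (commutator m y) = commutator (d m - \<delta> m) y + commutator m (\<phi> y)"
  unfolding parts_off(1,3)[OF assms] by (rule bracket_ef[OF assms])

lemma bracket':
  assumes "t \<in> peirce f e"
  shows "\<phi> (commutator t y) = commutator (d t - \<delta> t) y + commutator t (\<phi> y)"
  unfolding parts_off_fe(1,3)[OF assms] by (rule bracket_fe[OF assms])

lemma peirce_eqD: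
  assumes "m + t = m' + t'" "m \<in> peirce e f" "m' \<in> peirce e f" "t \<in> peirce f e" "t' \<in> peirce f e"
  shows "m = m'" and "t = t'"
proof -
  have "e * (m + t) = e * (m' + t')" "f * (m + t) = f * (m' + t')" using assms(1) by simp_all
  then show "m = m'" "t = t'" using assms(2-) by (simp_all add: distrib_left peirce_simps)
qed

text \<open>Both rules are Peirce components of the bracket rule for \<open>[m, a] = - a m\<close>.\<close>

lemma parts_corner_off:
  assumes a: "a \<in> peirce e e" and m: "m \<in> peirce e f"
  shows "d (a * m) = d a * m + a * d m" and "\<delta> (a * m) = \<delta> m * a"
proof -
  note am = peirce_mult[OF a m]
  note pa = parts_corner[OF a] and pm = parts_off[OF m] and pam = parts_off[OF am]
  have z: "\<gamma> a * m = m * \<gamma> a" using central_part_centre by (rule centreD)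
  have "- \<phi> (a * m) = \<phi> (commutator m a)"
    using peirce_orthogonal(2)[OF m a] by (simp add: commutator_def phi_simps)
  also have "\<dots> = commutator (d m - \<delta> m) a + commutator m (d a + \<gamma> a)"
    using bracket[OF m] pa(3) by simp
  also have "\<dots> = - (d a * m + a * d m) - \<delta> m * a"
    using peirce_orthogonal(2)[OF pm(6) a] peirce_orthogonal(1)[OF a pm(5)]
      peirce_orthogonal(2)[OF m pa(4)] z
    by (simp add: commutator_def algebra_simps)
  finally have "d (a * m) + \<delta> (a * m) = (d a * m + a * d m) + \<delta> m * a"
    using pam(4) by (simp add: algebra_simps)
  from peirce_eqD[OF this pam(6) peirce_add pam(5) peirce_mult]
  show "d (a * m) = d a * m + a * d m" and "\<delta> (a * m) = \<delta> m * a"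
    using peirce_mult a m pa pm by blast+
qed

lemma parts_off_corner:
  assumes a: "a \<in> peirce e e" and t: "t \<in> peirce f e"
  shows "d (t * a) = d t * a + t * d a" and "\<delta> (t * a) = a * \<delta> t"
proof -
  note ta = peirce_mult[OF t a]
  note pa = parts_corner[OF a] and pt = parts_off_fe[OF t] and pta = parts_off_fe[OF ta]
  have z: "\<gamma> a * t = t * \<gamma> a" using central_part_centre by (rule centreD)
  have "\<phi> (t * a) = \<phi> (commutator t a)"
    using peirce_orthogonal(1)[OF a t] by (simp add: commutator_def phi_simps)
  also have "\<dots> = commutator (d t - \<delta> t) a + commutator t (d a + \<gamma> a)"
    using bracket'[OF t] pa(3) by simp
  also have "\<dots> = a * \<delta> t + (d t * a + t * d a)"
    using peirce_orthogonal(1)[OF a pt(6)] peirce_orthogonal(2)[OF pt(5) a]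
      peirce_orthogonal(1)[OF pa(4) t] z
    by (simp add: commutator_def algebra_simps)
  finally have "\<delta> (t * a) + d (t * a) = a * \<delta> t + (d t * a + t * d a)"
    using pta(4) by (simp add: algebra_simps)
  from peirce_eqD[OF this pta(5) peirce_mult pta(6) peirce_add]
  show "d (t * a) = d t * a + t * d a" and "\<delta> (t * a) = a * \<delta> t"
    using peirce_mult a t pa pt by blast+
qed

text \<open>Faithfulness reduces the product rule on the corner to the rules for \<open>a m\<close> and
  \<open>t a\<close>: expand \<open>d((a a') m) = d(a (a' m))\<close> in two ways, and likewise \<open>d(t (a a'))\<close>.\<close>

lemma derivation_corner:
  assumes a: "a \<in> peirce e e" and a': "a' \<in> peirce e e"
  shows "d (a * a') = d a * a' + a * d a'"
proof -
  note aa' = peirce_mult[OF a a']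
  note pa = parts_corner(4)[OF a] and pa' = parts_corner(4)[OF a'] and paa' = parts_corner(4)[OF aa']
  have "d (a * a') - (d a * a' + a * d a') \<in> peirce e e"
    using a a' pa pa' paa' by (intro peirce_diff peirce_add peirce_mult)
  then have "d (a * a') - (d a * a' + a * d a') = 0"
  proof (rule faithful_e)
    fix m assume m: "m \<in> peirce e f"
    show "(d (a * a') - (d a * a' + a * d a')) * m = 0"
      using parts_corner_off(1)[OF aa' m] parts_corner_off(1)[OF a peirce_mult[OF a' m]]
        parts_corner_off(1)[OF a' m]
      by (simp add: algebra_simps)
  next
    fix t assume t: "t \<in> peirce f e"
    show "t * (d (a * a') - (d a * a' + a * d a')) = 0"
      using parts_off_corner(1)[OF aa' t] parts_off_corner(1)[OF a' peirce_mult[OF t a]]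
        parts_off_corner(1)[OF a t]
      by (simp add: algebra_simps)
  qed
  then show ?thesis by simp
qed

text \<open>The bracket rule for \<open>[m, t]\<close> shows that the defects of the product rule at \<open>m t\<close> and at
  \<open>t m\<close>, which lie in different corners, differ by the central element
  \<open>\<gamma> (t m) - \<gamma> (m t)\<close>. That element has to vanish, and this is what the condition \<open>cross\<close>
  ensures.\<close>

lemma derivation_off_off:
  assumes m: "m \<in> peirce e f" and t: "t \<in> peirce f e"
  shows "d (m * t) = d m * t + m * d t"
proof -
  note mt = peirce_mult[OF m t] and tm = peirce_mult[OF t m]
  note pmt = parts_corner[OF mt] and ptm = parts_corner_f[OF tm]
  note pm = parts_off[OF m] and pt = parts_off_fe[OF t]
  let ?X = "d (m * t) - (d m * t + m * d t)" and ?Y = "d (t * m) - (d t * m + t * d m)"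
  let ?w = "\<gamma> (t * m) - \<gamma> (m * t)"
  have X: "?X \<in> peirce e e" and Y: "?Y \<in> peirce f f"
    by (rule peirce_diff[OF pmt(4) peirce_add[OF peirce_mult[OF pm(6) t] peirce_mult[OF m pt(6)]]],
        rule peirce_diff[OF ptm(4) peirce_add[OF peirce_mult[OF pt(6) m] peirce_mult[OF t pm(6)]]])
  have "\<phi> (m * t) - \<phi> (t * m) = \<phi> (commutator m t)"
    by (simp add: commutator_def phi_simps)
  also have "\<dots> = commutator (d m - \<delta> m) t + commutator m (d t + \<delta> t)"
    using bracket[OF m] pt(4) by simp
  also have "\<dots> = d m * t + m * d t - (d t * m + t * d m)"
    using peirce_orthogonal(1)[OF pm(5) t] peirce_orthogonal(1)[OF t pm(5)]
      peirce_orthogonal(2)[OF m pt(5)] peirce_orthogonal(2)[OF pt(5) m]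
    by (simp add: commutator_def algebra_simps)
  \<comment> \<open>The defects \<open>?X\<close> and \<open>?Y\<close> lie in opposite corners, so it is enough to show \<open>?w = 0\<close>.\<close>
  finally have XYw: "?X - ?Y = ?w"
    using pmt(3) ptm(3) by (simp add: algebra_simps)
  have w: "?w \<in> centre" by (simp add: central_part_centre centre_diff)
  have "e * \<phi> (t * m) * e + f * \<phi> (m * t) * f = e * \<gamma> (t * m) + f * \<gamma> (m * t)"
    using pmt(3,4) ptm(3,4) centreD[OF central_part_centre]
    by (simp add: algebra_simps peirce_simps idem_simps)
  then have "e * \<gamma> (t * m) + f * \<gamma> (m * t) \<in> centre"
    using cross[OF m t] by simp
  \<comment> \<open>This central element is \<open>f * ?w\<close>, which therefore vanishes as a central element of a corner.\<close>
  then have "\<gamma> (t * m) - (e * \<gamma> (t * m) + f * \<gamma> (m * t)) \<in> centre"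
    by (intro centre_diff central_part_centre)
  moreover have "e * \<gamma> (t * m) + f * \<gamma> (t * m) = \<gamma> (t * m)"
    by (simp add: e_plus_f flip: distrib_right)
  moreover have "f * ?w
      = (e * \<gamma> (t * m) + f * \<gamma> (t * m)) - (e * \<gamma> (t * m) + f * \<gamma> (m * t))"
    by (simp add: right_diff_distrib)
  ultimately have fw: "f * ?w \<in> centre"
    by simp
  have "f * ?w \<in> peirce f f"
    using centreD[OF w, of f] by (intro peirceI) (simp_all add: idem_simps)
  then have "f * ?w = 0"
    using fw faithful_peirce.central_corner_zero[OF swap_faithful] by blast
  moreover have "(e + f) * ?w = ?w" by (simp add: e_plus_f)
  ultimately have "e * ?w = ?w" by (simp only: distrib_right add_0_right)
  then have "?w \<in> peirce e e"
    using centreD[OF w, of e] by (intro peirceI) simp_all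
  then have "?w = 0" using w central_corner_zero by blast
  then have "?X = ?Y" using XYw by simp
  then have "?X = 0" using X Y peirce_disjoint by metis
  then show ?thesis by simp
qed

text \<open>The bracket rule for \<open>[m, m'] = 0\<close>: the terms with \<open>d\<close> vanish, and the remaining ones split
  between the two corners.\<close>

lemma flip_off:
  assumes m: "m \<in> peirce e f" and m': "m' \<in> peirce e f"
  shows "jordan_product (\<delta> m) m' + jordan_product m (\<delta> m') = 0"
proof -
  note pm = parts_off[OF m] and pm' = parts_off[OF m']
  let ?A = "m' * \<delta> m + m * \<delta> m'" and ?B = "\<delta> m * m' + \<delta> m' * m"
  have "0 = \<phi> (commutator m m')"
    using peirce_orthogonal(2)[OF m m'] peirce_orthogonal(2)[OF m' m]
    by (simp add: commutator_def phi_simps)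
  also have "\<dots> = commutator (d m - \<delta> m) m' + commutator m (d m' + \<delta> m')"
    using bracket[OF m] pm'(4) by simp
  also have "\<dots> = ?A - ?B"
    using peirce_orthogonal(2)[OF m pm'(6)] peirce_orthogonal(2)[OF pm'(6) m]
      peirce_orthogonal(2)[OF m' pm(6)] peirce_orthogonal(2)[OF pm(6) m']
    by (simp add: commutator_def algebra_simps)
  finally have "?A = ?B" by simp
  moreover have "?A \<in> peirce e e" "?B \<in> peirce f f"
    by (rule peirce_add[OF peirce_mult[OF m' pm(5)] peirce_mult[OF m pm'(5)]],
        rule peirce_add[OF peirce_mult[OF pm(5) m'] peirce_mult[OF pm'(5) m]])
  ultimately have "?A = 0" "?B = 0" using peirce_disjoint by metis+
  then show ?thesis by (simp add: jordan_product_def algebra_simps)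
qed

lemmas swapped_products =
  reduced_map.parts_corner_off[OF swap_reduced]
  reduced_map.parts_off_corner[OF swap_reduced]
  reduced_map.derivation_corner[OF swap_reduced]
  reduced_map.derivation_off_off[OF swap_reduced]
  reduced_map.flip_off[OF swap_reduced]

lemmas products_fe = swapped_products[unfolded
    flip_part_swap[of f e] central_part_swap[of f e] derivation_part_swap[of f e]]

lemma derivation_part_mem:
  "i \<in> {e, f} \<Longrightarrow> j \<in> {e, f} \<Longrightarrow> x \<in> peirce i j \<Longrightarrow> d x \<in> peirce i j"
  using parts_corner(4) parts_corner_f(4) parts_off(6) parts_off_fe(6) by blast

text \<open>Only products \<open>peirce i j * peirce j l\<close> carry information. They are the eight cases
  treated above, four of them by exchanging \<open>e\<close> and \<open>f\<close>.\<close>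

lemma derivation_part_derivation: "derivation scale d"
proof -
  note d_simps = module_hom.add[OF derivation_part_hom] module_hom.zero[OF derivation_part_hom]
  have "d (x * y) - (d x * y + x * d y) = 0" for x y
  proof (rule biadditive_zero[where B = "\<lambda>x y. d (x * y) - (d x * y + x * d y)"])
    fix i j k l x y
    assume ij: "i \<in> {e, f}" "j \<in> {e, f}" and kl: "k \<in> {e, f}" "l \<in> {e, f}"
      and x: "x \<in> peirce i j" and y: "y \<in> peirce k l"
    show "d (x * y) - (d x * y + x * d y) = 0"
    proof (cases "j = k")
      case True
      then show ?thesis
        using ij kl x y parts_corner_off(1) parts_off_corner(1) derivation_corner derivation_off_off
          products_fe by auto
    next
      case False
      then have "j * k = 0" using ij kl e_f f_e by auto
      from peirce_mult_zero[OF this x y] peirce_mult_zero[OF this derivation_part_mem[OF ij x] y]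
        peirce_mult_zero[OF this x derivation_part_mem[OF kl y]]
      show ?thesis by (simp add: d_simps)
    qed
  qed (simp_all add: d_simps algebra_simps)
  then show ?thesis
    unfolding derivation_def using derivation_part_hom by simp
qed

lemma flip_corner_off:
  assumes a: "a \<in> peirce e e"
  shows "m \<in> peirce e f \<Longrightarrow> \<delta> (jordan_product a m) = jordan_product (\<delta> a) m + jordan_product a (\<delta> m)"
    and "t \<in> peirce f e \<Longrightarrow> \<delta> (jordan_product a t) = jordan_product (\<delta> a) t + jordan_product a (\<delta> t)"
proof -
  assume m: "m \<in> peirce e f"
  show "\<delta> (jordan_product a m) = jordan_product (\<delta> a) m + jordan_product a (\<delta> m)"
    using parts_corner_off(2)[OF a m] parts_corner(1)[OF a] peirce_orthogonal(2)[OF m a]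
      peirce_orthogonal(1)[OF a parts_off(5)[OF m]]
    by (simp add: jordan_product_def)
next
  assume t: "t \<in> peirce f e"
  show "\<delta> (jordan_product a t) = jordan_product (\<delta> a) t + jordan_product a (\<delta> t)"
    using parts_off_corner(2)[OF a t] parts_corner(1)[OF a] peirce_orthogonal(1)[OF a t]
      peirce_orthogonal(2)[OF parts_off_fe(5)[OF t] a]
    by (simp add: jordan_product_def)
qed

lemma flip_off_off:
  assumes "m \<in> peirce e f" and "m' \<in> peirce e f"
  shows "\<delta> (jordan_product m m') = jordan_product (\<delta> m) m' + jordan_product m (\<delta> m')"
  using flip_off[OF assms] peirce_orthogonal(2)[OF assms] peirce_orthogonal(2)[OF assms(2,1)]
  by (simp add: jordan_product_def module_hom.zero[OF flip_hom])

lemma flip_ef_fe: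
  assumes m: "m \<in> peirce e f" and t: "t \<in> peirce f e"
  shows "\<delta> (jordan_product m t) = jordan_product (\<delta> m) t + jordan_product m (\<delta> t)"
proof -
  have "\<delta> (m * t) = 0" "\<delta> (t * m) = 0"
    using parts_corner(1) parts_corner_f(1) peirce_mult m t by blast+
  then show ?thesis
    using parts_off(5)[OF m] parts_off_fe(5)[OF t] m t
    by (simp add: jordan_product_def module_hom.add[OF flip_hom] peirce_orthogonal[of _ _ _ _])
qed

lemma flip_corners:
  assumes "a \<in> peirce e e"
  shows "a' \<in> peirce e e \<Longrightarrow> \<delta> (jordan_product a a') = jordan_product (\<delta> a) a' + jordan_product a (\<delta> a')"
    and "b \<in> peirce f f \<Longrightarrow> \<delta> (jordan_product a b) = jordan_product (\<delta> a) b + jordan_product a (\<delta> b)"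
proof -
  assume a': "a' \<in> peirce e e"
  then have "\<delta> (jordan_product a a') = 0"
    unfolding jordan_product_def using assms by (intro parts_corner(1) peirce_add peirce_mult)
  then show "\<delta> (jordan_product a a') = jordan_product (\<delta> a) a' + jordan_product a (\<delta> a')"
    using assms a' by (simp add: parts_corner(1) jordan_product_def)
next
  assume b: "b \<in> peirce f f"
  then show "\<delta> (jordan_product a b) = jordan_product (\<delta> a) b + jordan_product a (\<delta> b)"
    using assms peirce_orthogonal(1)[OF assms b] peirce_orthogonal(2)[OF b assms]
    by (simp add: parts_corner(1) parts_corner_f(1) jordan_product_def module_hom.zero[OF flip_hom])
qed

lemmas flip_rules_swapped =
  reduced_map.flip_corner_off[OF swap_reduced]
  reduced_map.flip_off_off[OF swap_reduced]
  reduced_map.flip_corners[OF swap_reduced]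

lemmas flip_rules = flip_corner_off flip_off_off flip_ef_fe flip_corners
  flip_rules_swapped[unfolded flip_part_swap[of f e]]

text \<open>The defect is symmetric in its arguments, so one order of each pair of Peirce components
  suffices.\<close>

lemma flip_part_jordan: "jordan_derivation scale \<delta>"
proof -
  have add: "\<delta> (x + y) = \<delta> x + \<delta> y" for x y by (rule module_hom.add[OF flip_hom])
  let ?B = "\<lambda>x y. \<delta> (jordan_product x y) - (jordan_product (\<delta> x) y + jordan_product x (\<delta> y))"
  have "?B x y = 0" for x y
  proof (rule biadditive_zero[where B = ?B])
    fix i j k l x y
    assume "i \<in> {e, f}" "j \<in> {e, f}" "k \<in> {e, f}" "l \<in> {e, f}"
      and "x \<in> peirce i j" and "y \<in> peirce k l"
    then have "?B x y = 0 \<or> ?B y x = 0" by (elim insertE emptyE) (simp_all add: flip_rules)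
    moreover have "?B x y = ?B y x"
      by (simp add: jordan_product_def add.commute)
    ultimately show "?B x y = 0" by metis
  qed (simp_all add: add jordan_product_def algebra_simps)
  then show ?thesis
    unfolding jordan_derivation_def using flip_hom by simp
qed

lemma flip_part_singular: "singular_jordan_derivation scale e \<delta>"
proof -
  have f: "1 - e = f" using e_plus_f by (simp add: algebra_simps)
  have "\<delta> ` peirce e e = {0}" "\<delta> ` peirce f f = {0}"
    using parts_corner(1) parts_corner_f(1) peirce_zero by (auto simp: image_iff) (blast intro: peirce_zero)+
  moreover have "\<delta> ` peirce e f \<subseteq> peirce f e" "\<delta> ` peirce f e \<subseteq> peirce e f"
    using parts_off(5) parts_off_fe(5) by auto
  ultimately show ?thesis
    using flip_part_jordan by (simp add: singular_jordan_derivation_def f)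
qed

end

section \<open>Reduction to a normalized Lie derivation\<close>

context peirce_decomposition
begin

lemma commutator_f: "commutator x f = e * x * f - f * x * e"
proof -
  have "commutator x f = (e + f) * x * f - f * x * (e + f)"
    by (simp add: commutator_def e_plus_f)
  then show ?thesis by (simp add: algebra_simps)
qed

text \<open>Every bracket with \<open>f\<close> kills the corners, fixes \<open>e A f\<close> and negates \<open>f A e\<close>.\<close>

lemma ad_iter_f:
  "ad_iter f (Suc k) x = (if even k then e * x * f - f * x * e else e * x * f + f * x * e)"
  by (induction k) (simp_all add: commutator_f algebra_simps idem_simps)

lemma ad_iter_ef: "m \<in> peirce e f \<Longrightarrow> ad_iter f k m = m"
  by (cases k) (simp_all add: ad_iter_f peirce_simps del: ad_iter_Suc)

lemma ad_iter_fe: "t \<in> peirce f e \<Longrightarrow> ad_iter f k t = (if even k then t else - t)"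
  by (cases k) (simp_all add: ad_iter_f peirce_simps del: ad_iter_Suc)

lemma derivation_opposite_corner:
  assumes "derivation scale D" and "a \<in> peirce e e"
  shows "f * D a * f = 0"
proof -
  have "D a = D e * a + e * D a"
    using assms peirce_left(1)[OF assms(2)] unfolding derivation_def by metis
  then have "f * D a * f = f * (D e * a + e * D a) * f" by simp
  also have "\<dots> = 0"
    using assms(2) by (simp add: algebra_simps idem_simps peirce_simps)
  finally show ?thesis .
qed

lemma corner_eI: "y * f = f * y \<Longrightarrow> f * y * f = 0 \<Longrightarrow> y \<in> peirce e e"
  using peirce_sum[of y] peirce_sandwich[of e y e] by (simp add: commute_f_iff)

end

text \<open>Here \<open>n = k + 2\<close>, so that \<open>k\<close> counts the copies of \<open>f\<close> between the first and the
  last argument of \<open>p\<^sub>n(x, f, \<dots>, f, y)\<close>.\<close>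

locale normalized_lie_derivation = faithful_peirce e f
  for e f :: "'a::ring_1" and scale :: "'r::comm_ring_1 \<Rightarrow> 'a \<Rightarrow> 'a" and k :: nat +
  fixes \<phi> :: "'a \<Rightarrow> 'a"
  assumes lie: "lie_n_derivation scale (k + 2) \<phi>"
    and comm: "f * \<phi> f = \<phi> f * f"
    and torsion: "of_nat (k + 1) * (x :: 'a) = 0 \<Longrightarrow> x = 0"
    and two_torsion: "x + x = 0 \<Longrightarrow> x = (0 :: 'a)"
begin

lemma hom: "module_hom scale scale \<phi>"
  using lie by (simp add: lie_n_derivation_def)

lemmas phi_zero = module_hom.zero[OF hom]
lemmas phi_neg = module_hom.neg[OF hom]

text \<open>The identity \<open>lie_n_derivation_ad_iter\<close> at \<open>y = f\<close>: all \<open>n - 1\<close> copies of \<open>f\<close> now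
  contribute the same bracket.\<close>

lemma phi_ad_iter:
  "\<phi> (ad_iter f (Suc k) x) = ad_iter f (Suc k) (\<phi> x) + of_nat (k + 1) * commutator (ad_iter f k x) (\<phi> f)"
proof -
  have "of_nat k * commutator (commutator (ad_iter f (k - 1) x) (\<phi> f)) f
      = of_nat k * commutator (ad_iter f k x) (\<phi> f)"
    using commutator_right_swap[OF comm] by (cases k) simp_all
  then show ?thesis
    using lie_n_derivation_ad_iter[OF lie comm, of x f] by (simp add: distrib_right add.assoc)
qed

lemma sandwich_of_nat: "i * (of_nat j * x) * l = of_nat j * (i * x * l)"
  by (metis mult.assoc mult_of_nat_commute)

lemma ad_iter_parts:
  "e * ad_iter f (Suc k) x * f = e * x * f"
  "f * ad_iter f (Suc k) x * e = (if even k then - (f * x * e) else f * x * e)"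
  by (simp_all add: ad_iter_f algebra_simps idem_simps del: ad_iter_Suc)

text \<open>Compare both sides of \<open>phi_ad_iter\<close> in the off-diagonal component that contains the
  argument: the contributions of \<open>\<phi>\<close> at the argument cancel, and what is left is a multiple of
  the bracket by \<open>k + 1 = n - 1\<close>.\<close>

lemma phi_f_commutator:
  "m \<in> peirce e f \<Longrightarrow> commutator m (\<phi> f) = 0"
  "t \<in> peirce f e \<Longrightarrow> commutator t (\<phi> f) = 0"
proof -
  have fc: "\<phi> f * f = f * \<phi> f" by (simp add: comm)
  have "\<phi> f * (e + f) = (e + f) * \<phi> f" by (simp add: e_plus_f)
  then have ec: "\<phi> f * e = e * \<phi> f" by (simp add: distrib_left distrib_right fc)
  {
    assume m: "m \<in> peirce e f"
    have "e * \<phi> m * f = e * \<phi> m * f + of_nat (k + 1) * (e * commutator m (\<phi> f) * f)"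
      using arg_cong[OF phi_ad_iter[of m], of "\<lambda>x. e * x * f"] ad_iter_parts(1)[of "\<phi> m"]
      by (simp only: ad_iter_ef[OF m] distrib_left distrib_right sandwich_of_nat)
    then have "of_nat (k + 1) * (e * commutator m (\<phi> f) * f) = 0"
      by (metis add_cancel_left_right)
    then have "e * commutator m (\<phi> f) * f = 0"
      by (rule torsion)
    moreover have "commutator m (\<phi> f) \<in> peirce e f"
      by (rule peirce_commutator[OF m ec comm])
    ultimately show "commutator m (\<phi> f) = 0" by (simp add: peirce_simps)
  }
  {
    assume t: "t \<in> peirce f e"
    have "f * \<phi> (ad_iter f (Suc k) t) * e = f * ad_iter f (Suc k) (\<phi> t) * e"
      by (simp only: ad_iter_parts ad_iter_fe[OF t]) (simp add: phi_neg)
    moreover have "f * \<phi> (ad_iter f (Suc k) t) * e = f * ad_iter f (Suc k) (\<phi> t) * e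
        + of_nat (k + 1) * (f * commutator (ad_iter f k t) (\<phi> f) * e)"
      by (simp only: phi_ad_iter distrib_left distrib_right sandwich_of_nat)
    ultimately have "of_nat (k + 1) * (f * commutator (ad_iter f k t) (\<phi> f) * e) = 0"
      by (metis add_cancel_left_right)
    then have "f * commutator (ad_iter f k t) (\<phi> f) * e = 0"
      by (rule torsion)
    then have "f * commutator t (\<phi> f) * e = 0"
      by (simp add: ad_iter_fe[OF t] commutator_def algebra_simps split: if_splits)
    moreover have "commutator t (\<phi> f) \<in> peirce f e"
      by (rule peirce_commutator[OF t comm[symmetric] ec[symmetric]])
    ultimately show "commutator t (\<phi> f) = 0" by (simp add: peirce_simps)
  }
qed

lemma phi_f_central: "\<phi> f \<in> centre"
  using phi_f_commutator comm by (intro centreI) (simp_all add: commutator_def)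

lemma phi_ad_iter': "\<phi> (ad_iter f (Suc k) x) = ad_iter f (Suc k) (\<phi> x)"
  unfolding phi_ad_iter by (simp add: commutator_centre[OF phi_f_central])

text \<open>By \<open>phi_ad_iter'\<close>, \<open>\<phi> m\<close> is fixed by the iterated bracket with \<open>f\<close>, which kills the
  corners. For even \<open>k\<close> it also negates \<open>f A e\<close>, so that component is its own negative.\<close>

lemma phi_off:
  assumes "m \<in> peirce e f"
  shows "\<phi> m = e * \<phi> m * f + f * \<phi> m * e" and "even k \<Longrightarrow> f * \<phi> m * e = 0"
proof -
  have eq: "\<phi> m = ad_iter f (Suc k) (\<phi> m)"
    using phi_ad_iter'[of m] by (simp only: ad_iter_ef[OF assms])
  show even: "f * \<phi> m * e = 0" if "even k"
  proof -
    have "f * \<phi> m * e = - (f * \<phi> m * e)"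
      using ad_iter_parts(2)[of "\<phi> m"] unfolding eq[symmetric] if_P[OF that] .
    then show ?thesis using eq_neg_iff_add_eq_0 two_torsion by blast
  qed
  show "\<phi> m = e * \<phi> m * f + f * \<phi> m * e"
    using eq even unfolding ad_iter_f by (cases "even k") simp_all
qed

lemma phi_off':
  assumes "t \<in> peirce f e"
  shows "\<phi> t = f * \<phi> t * e + e * \<phi> t * f" and "even k \<Longrightarrow> e * \<phi> t * f = 0"
proof -
  have eq: "(if even k then - \<phi> t else \<phi> t) = ad_iter f (Suc k) (\<phi> t)"
    using phi_ad_iter'[of t] unfolding ad_iter_fe[OF assms] by (simp add: phi_neg split: if_splits)
  show even: "e * \<phi> t * f = 0" if "even k"
  proof -
    have "e * - \<phi> t * f = e * \<phi> t * f"
      using ad_iter_parts(1)[of "\<phi> t"] unfolding eq[symmetric] if_P[OF that] .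
    then have "e * \<phi> t * f = - (e * \<phi> t * f)"
      by (metis mult_minus_left mult_minus_right)
    then show ?thesis using eq_neg_iff_add_eq_0 two_torsion by blast
  qed
  show "\<phi> t = f * \<phi> t * e + e * \<phi> t * f"
  proof (cases "even k")
    case True
    then have "- \<phi> t = - (f * \<phi> t * e)" using eq even unfolding ad_iter_f by simp
    then show ?thesis using even True by simp
  next
    case False
    then show ?thesis using eq unfolding ad_iter_f by (simp add: add.commute)
  qed
qed

lemma phi_commutes_f:
  assumes "x * f = f * x"
  shows "\<phi> x * f = f * \<phi> x"
proof -
  have "ad_iter f (Suc k) x = 0"
    using assms unfolding commute_f_iff ad_iter_f by simp
  then have "ad_iter f (Suc k) (\<phi> x) = 0"
    using phi_ad_iter'[of x] by (simp only: phi_zero)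
  then show ?thesis
    unfolding commute_f_iff using ad_iter_parts[of "\<phi> x"] by (simp split: if_splits)
qed

lemma phi_bracket:
  "\<phi> (commutator (ad_iter f k x) y) = commutator (ad_iter f k (\<phi> x)) y + commutator (ad_iter f k x) (\<phi> y)"
  unfolding lie_n_derivation_ad_iter[OF lie comm] commutator_centre[OF phi_f_central]
  by (simp add: commutator_def)

lemma phi_bracket_ef:
  assumes "m \<in> peirce e f"
  shows "\<phi> (commutator m y) = commutator (e * \<phi> m * f - f * \<phi> m * e) y + commutator m (\<phi> y)"
proof -
  have "ad_iter f k (\<phi> m) = e * \<phi> m * f - f * \<phi> m * e"
  proof (cases k)
    case 0
    then show ?thesis using phi_off[OF assms] by (metis ad_iter_0 add_0_right diff_zero even_zero)
  next
    case (Suc j)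
    then show ?thesis using phi_off(2)[OF assms] Suc by (simp add: ad_iter_f del: ad_iter_Suc)
  qed
  then show ?thesis using phi_bracket[of m y] unfolding ad_iter_ef[OF assms] by simp
qed

lemma phi_bracket_fe:
  assumes "t \<in> peirce f e"
  shows "\<phi> (commutator t y) = commutator (f * \<phi> t * e - e * \<phi> t * f) y + commutator t (\<phi> y)"
proof -
  have neg: "commutator (- u) v = - commutator u v" for u v :: 'a
    by (simp add: commutator_def)
  have ad: "ad_iter f k (\<phi> t) = (if even k then f * \<phi> t * e - e * \<phi> t * f
      else - (f * \<phi> t * e - e * \<phi> t * f))"
  proof (cases k)
    case 0
    then show ?thesis using phi_off'[OF assms] by (metis ad_iter_0 add_0_right diff_zero even_zero)
  next
    case (Suc j)
    then show ?thesis using phi_off'(2)[OF assms] Suc by (simp add: ad_iter_f del: ad_iter_Suc)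
  qed
  show ?thesis
  proof (cases "even k")
    case True
    show ?thesis
      using phi_bracket[of t y] unfolding ad_iter_fe[OF assms] ad if_P[OF True] .
  next
    case False
    have "- \<phi> (commutator t y)
        = - (commutator (f * \<phi> t * e - e * \<phi> t * f) y + commutator t (\<phi> y))"
      using phi_bracket[of t y] unfolding ad_iter_fe[OF assms] ad if_not_P[OF False]
      by (simp only: neg phi_neg minus_add_distrib)
    then show ?thesis by (simp only: neg_equal_iff_equal)
  qed
qed

text \<open>The image \<open>\<phi> a\<close> of a corner element is block diagonal, so a central \<open>z\<close> with the same
  \<open>f\<close>-corner moves it into the corner of \<open>e\<close>.\<close>

lemma decomposition:
  assumes "unital_algebra scale"
    and corner_e: "\<And>a. a \<in> peirce e e \<Longrightarrow> \<exists>z \<in> centre. f * \<phi> a * f = f * z * f"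
    and corner_f: "\<And>b. b \<in> peirce f f \<Longrightarrow> \<exists>z \<in> centre. e * \<phi> b * e = e * z * e"
    and cross: "\<And>m t. m \<in> peirce e f \<Longrightarrow> t \<in> peirce f e \<Longrightarrow>
      e * \<phi> (t * m) * e + f * \<phi> (m * t) * f \<in> centre"
  shows "\<exists>d \<delta> \<gamma>. \<phi> = (\<lambda>x. d x + \<delta> x + \<gamma> x) \<and> derivation scale d \<and>
    singular_jordan_derivation scale e \<delta> \<and>
    module_hom scale scale \<gamma> \<and> range \<gamma> \<subseteq> centre \<and> (\<forall>x. \<gamma> (lie_poly (k + 2) x) = 0)"
proof -
  have commutes_e: "x * e = e * x" if "x * f = f * x" for x
  proof -
    have "x * (e + f) = (e + f) * x" by (simp add: e_plus_f)
    then show ?thesis by (simp add: distrib_left distrib_right that)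
  qed
  have shift_e: "\<exists>z \<in> centre. \<phi> a - z \<in> peirce e e" if a: "a \<in> peirce e e" for a
  proof -
    obtain z where z: "z \<in> centre" "f * \<phi> a * f = f * z * f" using corner_e[OF a] by blast
    have "\<phi> a * f = f * \<phi> a" using a by (intro phi_commutes_f) (simp add: peirce_simps)
    then have "\<phi> a - z \<in> peirce e e"
      using z centreD[OF z(1), of f] by (intro corner_eI) (simp_all add: algebra_simps)
    then show ?thesis using z(1) by blast
  qed
  have shift_f: "\<exists>z \<in> centre. \<phi> b - z \<in> peirce f f" if b: "b \<in> peirce f f" for b
  proof -
    obtain z where z: "z \<in> centre" "e * \<phi> b * e = e * z * e" using corner_f[OF b] by blast
    have "\<phi> b * f = f * \<phi> b" using b by (intro phi_commutes_f) (simp add: peirce_simps)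
    then have "\<phi> b - z \<in> peirce f f"
      using z centreD[OF z(1), of e] commutes_e
      by (intro peirce_decomposition.corner_eI[OF swap]) (simp_all add: algebra_simps)
    then show ?thesis using z(1) by blast
  qed
  interpret reduced_map e f scale \<phi>
    by (intro reduced_map.intro faithful_peirce_axioms assms(1) reduced_map_axioms.intro hom
        phi_bracket_ef phi_bracket_fe phi_off(1) phi_off'(1) shift_e shift_f cross)
  have flip_lie: "lie_n_derivation scale (k + 2) \<delta>"
  proof (cases "even k")
    case True
    have "\<delta> = (\<lambda>x. 0)"
      using phi_off(2)[OF peirce_sandwich True] phi_off'(2)[OF peirce_sandwich True]
      by (simp add: fun_eq_iff flip_part_def)
    then have "derivation scale \<delta>"
      using flip_hom by (simp add: derivation_def)
    then show ?thesis by (rule lie_n_derivation_of_derivation) simp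
  next
    case False
    then show ?thesis by (intro lie_n_derivation_of_jordan_derivation flip_part_jordan) simp
  qed
  have "\<gamma> = (\<lambda>x. \<phi> x - d x - \<delta> x)"
    by (simp add: fun_eq_iff derivation_part_def)
  then have "lie_n_derivation scale (k + 2) \<gamma>"
    using lie_n_derivation_diff[OF lie_n_derivation_diff[OF lie
          lie_n_derivation_of_derivation[OF derivation_part_derivation]] flip_lie] by simp
  moreover have "range \<gamma> \<subseteq> centre" using central_part_centre by blast
  ultimately have "\<gamma> (lie_poly (k + 2) x) = 0" for x
    by (rule lie_n_derivation_central_vanishes) simp
  moreover have "\<phi> = (\<lambda>x. d x + \<delta> x + \<gamma> x)"
    by (simp add: fun_eq_iff derivation_part_def)
  ultimately show ?thesis
    using derivation_part_derivation flip_part_singular central_hom \<open>range \<gamma> \<subseteq> centre\<close> by blast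
qed

end

section \<open>The characterization\<close>

lemma derivation_add:
  assumes "derivation scale d" and "derivation scale d'"
  shows "derivation scale (\<lambda>x. d x + d' x)"
  using assms unfolding derivation_def module_hom_iff
  by (auto simp: module.scale_right_distrib distrib_left distrib_right)

lemma inner_derivation:
  assumes "unital_algebra scale"
  shows "derivation scale (\<lambda>x. commutator x g)"
proof -
  interpret unital_algebra scale by fact
  show ?thesis
    unfolding derivation_def module_hom_iff
    by (simp add: module_axioms commutator_def scale_mult_left scale_mult_right
        scale_right_diff_distrib algebra_simps)
qed

theorem theorem2p4:
  fixes scale :: "'r::comm_ring_1 \<Rightarrow> 'a::ring_1 \<Rightarrow> 'a"
    and e f :: 'a and \<phi> :: "'a \<Rightarrow> 'a" and n :: nat
  assumes "n \<ge> 2"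
    and "unital_algebra scale"
    and "nontrivial_idempotent e"
    and "f = 1 - e"
    and "torsion_free 2 TYPE('a)"
    and "torsion_free (n - 1) TYPE('a)"
    and "\<And>x. (\<lambda>y. (e * x * e) * y) ` peirce e f = {0} \<Longrightarrow>
          (\<lambda>y. y * (e * x * e)) ` peirce f e = {0} \<Longrightarrow> e * x * e = 0"
    and "\<And>x. (\<lambda>y. y * (f * x * f)) ` peirce e f = {0} \<Longrightarrow>
          (\<lambda>y. (f * x * f) * y) ` peirce f e = {0} \<Longrightarrow> f * x * f = 0"
    and "lie_n_derivation scale n \<phi>"
  shows "(\<exists>d \<delta> \<gamma>. \<phi> = (\<lambda>x. d x + \<delta> x + \<gamma> x) \<and>
            derivation scale d \<and>
            singular_jordan_derivation scale e \<delta> \<and>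
            module_hom scale scale \<gamma> \<and> range \<gamma> \<subseteq> centre \<and> (\<forall>x. \<gamma> (lie_poly n x) = 0))
      \<longleftrightarrow>
         (sandwich f (\<phi> ` peirce e e) f \<subseteq> sandwich f centre f \<and>
          sandwich e (\<phi> ` peirce f f) e \<subseteq> sandwich e centre e) \<and>
         (\<forall>m \<in> peirce e f. \<forall>t \<in> peirce f e. e * \<phi> (t * m) * e + f * \<phi> (m * t) * f \<in> centre)"
    (is "?decomposes \<longleftrightarrow> ?conditions")
proof -
  obtain k where n: "n = k + 2" using \<open>n \<ge> 2\<close> by (metis add.commute le_Suc_ex)
  have "e * e = e" using assms(3) by (simp add: nontrivial_idempotent_def)
  then interpret peirce_decomposition e f
    by unfold_locales (simp_all add: \<open>f = 1 - e\<close> algebra_simps)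
  interpret swapped: peirce_decomposition f e by (rule swap)
  have image_zero: "g ` peirce i j = {0}" if "\<And>y. y \<in> peirce i j \<Longrightarrow> g y = 0"
    for g :: "'a \<Rightarrow> 'a" and i j
  proof -
    have "g ` peirce i j = (\<lambda>y. 0) ` peirce i j"
      using that by (rule image_cong[OF refl])
    then show ?thesis by (simp only: image_constant[OF peirce_zero])
  qed
  interpret faithful_peirce e f
  proof
    fix a assume a: "a \<in> peirce e e" "\<And>m. m \<in> peirce e f \<Longrightarrow> a * m = 0"
      "\<And>t. t \<in> peirce f e \<Longrightarrow> t * a = 0"
    have "e * a * e = a" using a(1) by (simp add: peirce_simps)
    then show "a = 0"
      using assms(7)[of a] image_zero[of e f "\<lambda>y. a * y"] image_zero[of f e "\<lambda>y. y * a"] a by simp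
  next
    fix b assume b: "b \<in> peirce f f" "\<And>t. t \<in> peirce f e \<Longrightarrow> b * t = 0"
      "\<And>m. m \<in> peirce e f \<Longrightarrow> m * b = 0"
    have "f * b * f = b" using b(1) by (simp add: peirce_simps)
    then show "b = 0"
      using assms(8)[of b] image_zero[of e f "\<lambda>y. y * b"] image_zero[of f e "\<lambda>y. b * y"] b by simp
  qed
  show ?thesis
  proof
    assume ?decomposes
    then obtain d \<delta> \<gamma> where \<phi>: "\<And>x. \<phi> x = d x + \<delta> x + \<gamma> x" and d: "derivation scale d"
      and \<delta>: "singular_jordan_derivation scale e \<delta>" and \<gamma>: "module_hom scale scale \<gamma>"
      and centre: "range \<gamma> \<subseteq> centre" and vanish: "\<And>x. \<gamma> (lie_poly n x) = 0"
      by (auto simp: fun_eq_iff)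
    have \<delta>_corners: "a \<in> peirce e e \<Longrightarrow> \<delta> a = 0" "a \<in> peirce f f \<Longrightarrow> \<delta> a = 0" for a
      using \<delta> unfolding singular_jordan_derivation_def Let_def \<open>f = 1 - e\<close>[symmetric] by auto
    have corner_e: "f * \<phi> a * f = f * \<gamma> a * f" if "a \<in> peirce e e" for a
      using derivation_opposite_corner[OF d that] \<delta>_corners(1)[OF that] by (simp add: \<phi> algebra_simps)
    have corner_f: "e * \<phi> b * e = e * \<gamma> b * e" if "b \<in> peirce f f" for b
      using swapped.derivation_opposite_corner[OF d that] \<delta>_corners(2)[OF that]
      by (simp add: \<phi> algebra_simps)
    have "e * \<phi> (t * m) * e + f * \<phi> (m * t) * f \<in> centre"
      if m: "m \<in> peirce e f" and t: "t \<in> peirce f e" for m t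
    proof -
      have "\<gamma> (commutator m t) = 0"
        using vanish lie_poly_ad_iter_last[of k m f t] unfolding n ad_iter_ef[OF m] by metis
      then have eq: "\<gamma> (m * t) = \<gamma> (t * m)"
        by (simp add: commutator_def module_hom.diff[OF \<gamma>])
      have z: "\<gamma> (t * m) \<in> centre" using centre by blast
      have "e * \<phi> (t * m) * e + f * \<phi> (m * t) * f = e * \<gamma> (t * m) * e + f * \<gamma> (t * m) * f"
        using corner_e[OF peirce_mult[OF m t]] corner_f[OF peirce_mult[OF t m]] eq by simp
      also have "\<dots> = \<gamma> (t * m) * (e + f)"
        using centreD[OF z, of e, symmetric] centreD[OF z, of f, symmetric]
        by (simp add: distrib_left idem_simps)
      finally show ?thesis using z e_plus_f by simp
    qed
    moreover have "f * \<phi> a * f \<in> sandwich f centre f" if "a \<in> peirce e e" for a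
      unfolding corner_e[OF that] sandwich_def[of f centre] using centre by blast
    moreover have "e * \<phi> b * e \<in> sandwich e centre e" if "b \<in> peirce f f" for b
      unfolding corner_f[OF that] sandwich_def[of e centre] using centre by blast
    ultimately show ?conditions
      unfolding sandwich_def[of f "\<phi> ` _"] sandwich_def[of e "\<phi> ` _"] by blast
  next
    assume conditions: ?conditions
    \<comment> \<open>The value of \<open>?D\<close> at \<open>f\<close> is the off-diagonal part of \<open>\<phi> f\<close>.\<close>
    let ?g = "f * \<phi> f * e - e * \<phi> f * f"
    let ?D = "\<lambda>x. commutator x ?g"
    define \<psi> where "\<psi> = (\<lambda>x. \<phi> x - ?D x)"
    have D: "derivation scale ?D" using inner_derivation[OF assms(2)] .
    have \<psi>_lie: "lie_n_derivation scale (k + 2) \<psi>"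
      unfolding \<psi>_def n[symmetric] using assms(1)
      by (intro lie_n_derivation_diff assms(9) lie_n_derivation_of_derivation[OF D]) simp
    have \<psi>_comm: "f * \<psi> f = \<psi> f * f"
    proof -
      have "e * \<psi> f * f = 0 \<and> f * \<psi> f * e = 0"
        by (simp add: \<psi>_def commutator_def algebra_simps idem_simps)
      then show ?thesis by (simp add: commute_f_iff[symmetric])
    qed
    have torsion: "x = 0" if "of_nat (k + 1) * x = 0" for x :: 'a
    proof -
      have "n - 1 = k + 1" by (simp add: n)
      then show ?thesis using assms(6) that unfolding torsion_free_def by metis
    qed
    have two_torsion: "x = 0" if "x + x = 0" for x :: 'a
    proof -
      have "of_nat 2 * x = 0" using that by (simp add: mult_2)
      then show ?thesis using assms(5) unfolding torsion_free_def by blast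
    qed
    interpret normalized_lie_derivation e f scale k \<psi>
      by unfold_locales (fact \<psi>_lie \<psi>_comm torsion two_torsion)+
    \<comment> \<open>Derivations do not contribute to opposite corners, so the two conditions pass to \<open>\<psi>\<close>.\<close>
    have corner_e: "f * \<psi> a * f = f * \<phi> a * f" if "a \<in> peirce e e" for a
      using derivation_opposite_corner[OF D that] by (simp add: \<psi>_def left_diff_distrib right_diff_distrib)
    have corner_f: "e * \<psi> b * e = e * \<phi> b * e" if "b \<in> peirce f f" for b
      using swapped.derivation_opposite_corner[OF D that]
      by (simp add: \<psi>_def left_diff_distrib right_diff_distrib)
    have "\<exists>d \<delta> \<gamma>. \<psi> = (\<lambda>x. d x + \<delta> x + \<gamma> x) \<and> derivation scale d \<and>
      singular_jordan_derivation scale e \<delta> \<and>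
      module_hom scale scale \<gamma> \<and> range \<gamma> \<subseteq> centre \<and> (\<forall>x. \<gamma> (lie_poly n x) = 0)"
      unfolding n
    proof (rule decomposition[OF assms(2)])
      fix a assume a: "a \<in> peirce e e"
      then have "f * \<phi> a * f \<in> sandwich f centre f"
        using conditions unfolding sandwich_def[of f "\<phi> ` _"] by blast
      then show "\<exists>z\<in>centre. f * \<psi> a * f = f * z * f"
        unfolding corner_e[OF a] by (auto simp: sandwich_def[of _ centre])
    next
      fix b assume b: "b \<in> peirce f f"
      then have "e * \<phi> b * e \<in> sandwich e centre e"
        using conditions unfolding sandwich_def[of e "\<phi> ` _"] by blast
      then show "\<exists>z\<in>centre. e * \<psi> b * e = e * z * e"
        unfolding corner_f[OF b] by (auto simp: sandwich_def[of _ centre])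
    next
      fix m t assume m: "m \<in> peirce e f" and t: "t \<in> peirce f e"
      show "e * \<psi> (t * m) * e + f * \<psi> (m * t) * f \<in> centre"
        unfolding corner_f[OF peirce_mult[OF t m]] corner_e[OF peirce_mult[OF m t]]
        using conditions m t by blast
    qed
    then obtain d \<delta> \<gamma> where \<psi>: "\<psi> = (\<lambda>x. d x + \<delta> x + \<gamma> x)" and d: "derivation scale d"
      and rest: "singular_jordan_derivation scale e \<delta>" "module_hom scale scale \<gamma>"
        "range \<gamma> \<subseteq> centre" "\<forall>x. \<gamma> (lie_poly n x) = 0"
      by blast
    have "derivation scale (\<lambda>x. ?D x + d x)"
      using derivation_add[OF D d] .
    moreover have "\<phi> = (\<lambda>x. (?D x + d x) + \<delta> x + \<gamma> x)"
    proof
      fix x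
      have "\<phi> x = ?D x + \<psi> x" by (simp add: \<psi>_def)
      then show "\<phi> x = (?D x + d x) + \<delta> x + \<gamma> x"
        unfolding \<psi> by (simp only: add.assoc)
    qed
    ultimately show ?decomposes
      using rest
      by (intro exI[of _ "\<lambda>x. ?D x + d x"] exI[of _ \<delta>] exI[of _ \<gamma>] conjI)
  qed
qed

end
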